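(* For every $a\in\mathbb{C}$, $$F\!\left(a,2a-\tfrac13;\tfrac23;10-6\sqrt3\right)=\frac{3^{3/8-9a/4}\,(\sqrt3-1)^{1/2-3a}\sqrt{\pi}\;\Gamma(\tfrac23)}{2^{1/4-3a/2}\,\Gamma(\tfrac34-\tfrac12a)\,\Gamma(\tfrac12a+\tfrac5{12})}.$$
   Context: $F(a,b;c;x)=\sum_{n\ge0}\frac{(a,n)(b,n)}{(c,n)(1,n)}x^n$ with $(\alpha,n)=\Gamma(\alpha+n)/\Gamma(\alpha)$ is the Gauss hypergeometric series. For $t>0$ and $s\in\mathbb{C}$, $t^s=e^{s\log t}$ with real logarithm. $1/\Gamma$ is interpreted as $0$ at the poles of $\Gamma$. *)

theory Defs
  imports "HOL-Analysis.Analysis"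
begin

(* The symbol (alpha,n) = Gamma(alpha+n) / Gamma(alpha) is the rising factorial
   pochhammer alpha n (lemma pochhammer_Gamma); the latter also gives the intended
   value when alpha is a pole of Gamma, where the quotient has to be read as a limit.
   The series is meant for cmod x < 1 and c not a non-positive integer. *)
definition hypergeo_F :: "complex \<Rightarrow> complex \<Rightarrow> complex \<Rightarrow> complex \<Rightarrow> complex" where
  "hypergeo_F a b c x =
     (\<Sum>n. pochhammer a n * pochhammer b n / (pochhammer c n * pochhammer 1 n) * x ^ n)"

end

theory Submission
  imports Defs "HOL-Complex_Analysis.Complex_Analysis"
begin

text \<open>
  The Riemann scheme of \<open>F(a, 2a - 1/3; 2/3; x)\<close> has exponent differences \<open>1/3\<close> at \<open>0\<close>,
  \<open>1 - 3a\<close> at \<open>1\<close> and \<open>a - 1/3\<close> at infinity. Up to sign the second is three times the third, so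
  the scheme is the pullback, along a map \<open>\<phi>\<close> of degree four, of a scheme with differences
  \<open>1/3\<close>, \<open>1/2\<close> and \<open>a - 1/3\<close>, namely that of \<open>F(\<alpha>, \<beta>; 2/3; y)\<close> with
  \<open>\<alpha> = a/2 - 1/12\<close> and \<open>\<beta> = 1/4 - a/2\<close>: the fibre of \<open>\<phi>\<close> over \<open>0\<close> is \<open>0\<close> and the triple
  point \<open>-8\<close>, the fibre over infinity is infinity and the triple point \<open>1\<close>, and the fibre
  over \<open>1\<close> consists of the two double points \<open>10 \<plusminus> 6 \<surd>3\<close>, which cease to be singular because the
  exponent difference \<open>1/2\<close> is doubled there. This determines
  \<open>\<phi>(x) = - x (x + 8)^3 / (64 (1 - x)^3)\<close>, and comparing local exponents determines
  the algebraic factor in Goursat's quartic transformation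
  \<open>F(a, 2a - 1/3; 2/3; x) = (1 - x)^(1/4 - 3a/2) F(\<alpha>, \<beta>; 2/3; \<phi>(x))\<close>.

  Both sides solve the same hypergeometric equation and are holomorphic at \<open>0\<close> with value \<open>1\<close>;
  the exponent \<open>1/3\<close> at \<open>0\<close> is not an integer, so they agree near \<open>0\<close>
  (\<open>hypergeo_F_eq_pullback_near_0\<close>), hence along the whole segment from \<open>0\<close> towards
  \<open>x_0 = 10 - 6 \<surd>3\<close>, which \<open>\<phi>\<close> maps into the unit disc, and by continuity also at \<open>x_0\<close>, where
  \<open>\<phi>(x_0) = 1\<close> (\<open>hypergeo_F_eq_pullback_at_endpoint\<close>). Since \<open>2/3 - \<alpha> - \<beta> = 1/2\<close> does not depend
  on \<open>a\<close>, the series converges at \<open>1\<close> for every \<open>a\<close>; Gauss's theorem (\<open>hypergeo_F_Gauss\<close>) sums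
  it there and produces the factor \<open>\<Gamma>(1/2) = \<surd>\<pi>\<close>. The powers of \<open>2\<close>, \<open>3\<close> and \<open>\<surd>3 - 1\<close> come from
  the algebraic factor, as \<open>1 - x_0 = 3 \<surd>3 (\<surd>3 - 1)^2 / 2\<close>.
\<close>

section \<open>The hypergeometric series and its differential equation\<close>

lemma Re_pos_not_nonpos_Int: "Re c > 0 \<Longrightarrow> c \<notin> \<int>\<^sub>\<le>\<^sub>0"
  by (auto elim!: nonpos_Ints_cases)

text \<open>
  In terms of Euler's operator \<open>x d/dx\<close>, which is diagonal on monomials, the
  hypergeometric operator is a difference of a part that lowers degrees by one and a part that
  preserves them. Hence the equation is a two-term recurrence for the coefficients.
\<close>

lemma fps_hypergeo_ode_nth:
  fixes F :: "'a :: field_char_0 fps"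
  shows "fps_nth (fps_X * (1 - fps_X) * fps_deriv (fps_deriv F)
            + (fps_const c - fps_const (a + b + 1) * fps_X) * fps_deriv F
            - fps_const (a * b) * F) n
         = of_nat (Suc n) * (c + of_nat n) * fps_nth F (Suc n)
           - (a + of_nat n) * (b + of_nat n) * fps_nth F n"
proof -
  have eq: "fps_X * (1 - fps_X) * fps_deriv (fps_deriv F)
            + (fps_const c - fps_const (a + b + 1) * fps_X) * fps_deriv F
            - fps_const (a * b) * F =
     fps_X * fps_deriv (fps_deriv F) - fps_X * (fps_X * fps_deriv (fps_deriv F))
       + fps_const c * fps_deriv F - fps_const (a + b + 1) * (fps_X * fps_deriv F)
       - fps_const (a * b) * F"
    by (simp add: algebra_simps)
  show ?thesis unfolding eq
    by (cases n; cases "n - 1") (simp_all add: algebra_simps)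
qed

lemma fps_hypergeo2_Suc:
  fixes a b c :: "'a :: field_char_0"
  assumes "c \<notin> \<int>\<^sub>\<le>\<^sub>0"
  shows "of_nat (Suc n) * (c + of_nat n) * fps_nth (fps_hypergeo [a, b] [c] 1) (Suc n)
         = (a + of_nat n) * (b + of_nat n) * fps_nth (fps_hypergeo [a, b] [c] 1) n"
proof -
  have "c + of_nat n \<noteq> 0" using assms by (metis plus_of_nat_eq_0_imp)
  moreover have "of_nat (Suc n) \<noteq> (0::'a)" by (rule of_nat_neq_0)
  ultimately show ?thesis
    by (simp add: fps_hypergeo_rec divide_simps del: of_nat_Suc fps_hypergeo_nth)
qed

lemma hypergeo_F_eq_eval_fps:
  "hypergeo_F a b c x = eval_fps (fps_hypergeo [a, b] [c] 1) x"
  by (simp add: hypergeo_F_def eval_fps_def flip: pochhammer_fact)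

text \<open>
  Ratio test: the quotient of consecutive coefficients tends to \<open>1\<close>. The test is
  used in its inequality form because the coefficients vanish eventually when \<open>a\<close>
  or \<open>b\<close> is a non-positive integer.
\<close>

lemma fps_conv_radius_hypergeo2:
  fixes a b c :: complex
  assumes "c \<notin> \<int>\<^sub>\<le>\<^sub>0"
  shows "fps_conv_radius (fps_hypergeo [a, b] [c] 1) \<ge> 1"
  unfolding fps_conv_radius_def
proof (rule conv_radius_geI_ex)
  fix r :: real assume r: "0 < r" "ereal r < 1"
  let ?t = "\<lambda>n. fps_nth (fps_hypergeo [a, b] [c] 1) n"
  let ?q = "\<lambda>n. (a + of_nat n) * (b + of_nat n) / (of_nat (Suc n) * (c + of_nat n))"
  have nz: "c + of_nat n \<noteq> 0" for n using assms by (metis plus_of_nat_eq_0_imp)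
  have step: "?t (Suc n) = ?q n * ?t n" for n
    using nz[of n]
    by (simp add: fps_hypergeo_rec divide_simps del: of_nat_Suc fps_hypergeo_nth)
  have lim: "(\<lambda>n. (z + of_nat n) / of_nat n) \<longlonglongrightarrow> (1::complex)" for z
  proof -
    have "(\<lambda>n. z / of_nat n + 1) \<longlonglongrightarrow> (0 + 1::complex)"
      by (intro tendsto_intros lim_const_over_n)
    moreover have "eventually (\<lambda>n. z / of_nat n + 1 = (z + of_nat n) / of_nat n) sequentially"
      using eventually_gt_at_top[of 0] by eventually_elim (simp add: field_simps)
    ultimately show ?thesis by (simp add: tendsto_cong)
  qed
  have "(\<lambda>n. ((a + of_nat n) / of_nat n) * ((b + of_nat n) / of_nat n)
          / (((1 + of_nat n) / of_nat n) * ((c + of_nat n) / of_nat n))) \<longlonglongrightarrow> 1 * 1 / (1 * 1)"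
    by (intro tendsto_intros lim) auto
  moreover have "eventually (\<lambda>n. ((a + of_nat n) / of_nat n) * ((b + of_nat n) / of_nat n)
          / (((1 + of_nat n) / of_nat n) * ((c + of_nat n) / of_nat n)) = ?q n) sequentially"
    using eventually_gt_at_top[of 0] by eventually_elim (auto simp add: divide_simps)
  ultimately have "?q \<longlonglongrightarrow> 1 * 1 / (1 * 1)" by (rule Lim_transform_eventually)
  hence "?q \<longlonglongrightarrow> 1" by (simp only: mult_1 div_by_1)
  hence "(\<lambda>n. norm (?q n) * r) \<longlonglongrightarrow> norm (1::complex) * r" by (intro tendsto_intros)
  moreover obtain s where s: "r < s" "s < 1" using r dense by (metis ereal_less(3))
  ultimately have "eventually (\<lambda>n. norm (?q n) * r < s) sequentially"
    by (intro order_tendstoD(2)) auto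
  then obtain N where N: "\<And>n. n \<ge> N \<Longrightarrow> norm (?q n) * r < s"
    by (auto simp: eventually_at_top_linorder)
  have "summable (\<lambda>n. ?t n * of_real r ^ n)"
  proof (rule summable_ratio_test)
    show "s < 1" by fact
    fix n assume "n \<ge> N"
    have "norm (?t (Suc n) * of_real r ^ Suc n) = (norm (?q n) * r) * norm (?t n * of_real r ^ n)"
      unfolding step using r
      by (simp add: norm_mult norm_divide norm_power del: fps_hypergeo_nth of_nat_Suc)
    also have "\<dots> \<le> s * norm (?t n * of_real r ^ n)"
      using N[OF \<open>n \<ge> N\<close>] by (intro mult_right_mono) auto
    finally show "norm (?t (Suc n) * of_real r ^ Suc n) \<le> s * norm (?t n * of_real r ^ n)" .
  qed
  thus "\<exists>z::complex. norm z = r \<and> summable (\<lambda>n. ?t n * z ^ n)"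
    using r by (intro exI[of _ "of_real r"]) auto
qed

text \<open>
  For \<open>c\<close> as assumed, the only solutions of the hypergeometric equation that are
  holomorphic at \<open>0\<close> are the multiples of the hypergeometric series, because the
  recurrence then determines all coefficients from the first one. This direction identifies the
  pulled-back function; the converse supplies the equation for the function that is pulled back.
\<close>

lemma hypergeo_ode_iff:
  fixes a b c :: complex
  assumes f: "f has_fps_expansion F" and c: "c \<notin> \<int>\<^sub>\<le>\<^sub>0"
  shows "(\<forall>\<^sub>F x in nhds 0. x * (1 - x) * deriv (deriv f) x + (c - (a + b + 1) * x) * deriv f x
            - a * b * f x = 0)
         \<longleftrightarrow> F = fps_const (fps_nth F 0) * fps_hypergeo [a, b] [c] 1" (is "?ode \<longleftrightarrow> ?hyp")
proof -
  let ?D = "\<lambda>x. x * (1 - x) * deriv (deriv f) x + (c - (a + b + 1) * x) * deriv f x - a * b * f x"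
  let ?DF = "fps_X * (1 - fps_X) * fps_deriv (fps_deriv F)
            + (fps_const c - fps_const (a + b + 1) * fps_X) * fps_deriv F
            - fps_const (a * b) * F"
  have D: "?D has_fps_expansion ?DF"
    by (intro fps_expansion_intros f)
  have "?ode \<longleftrightarrow> ?D has_fps_expansion 0"
    by (rule has_fps_expansion_0_iff [symmetric])
  also have "\<dots> \<longleftrightarrow> ?DF = 0"
  proof
    assume "?D has_fps_expansion 0"
    with D show "?DF = 0" by (rule fps_expansion_unique_complex)
  next
    assume DF: "?DF = 0"
    show "?D has_fps_expansion 0" using D unfolding DF .
  qed
  also have "\<dots> \<longleftrightarrow> (\<forall>n. of_nat (Suc n) * (c + of_nat n) * fps_nth F (Suc n)
                      = (a + of_nat n) * (b + of_nat n) * fps_nth F n)"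
    unfolding fps_eq_iff fps_hypergeo_ode_nth by simp
  also have "\<dots> \<longleftrightarrow> ?hyp"
  proof
    assume rec: "\<forall>n. of_nat (Suc n) * (c + of_nat n) * fps_nth F (Suc n)
                      = (a + of_nat n) * (b + of_nat n) * fps_nth F n"
    show ?hyp
    proof (rule fps_ext)
      fix n
      show "fps_nth F n = fps_nth (fps_const (fps_nth F 0) * fps_hypergeo [a, b] [c] 1) n"
      proof (induction n)
        case 0
        show ?case by (simp del: fps_hypergeo_nth)
      next
        case (Suc n)
        let ?k = "of_nat (Suc n) * (c + of_nat n)"
        have "?k \<noteq> 0" using c by (metis plus_of_nat_eq_0_imp mult_eq_0_iff of_nat_neq_0)
        moreover have "?k * fps_nth F (Suc n)
            = ?k * fps_nth (fps_const (fps_nth F 0) * fps_hypergeo [a, b] [c] 1) (Suc n)"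
          using rec Suc fps_hypergeo2_Suc[OF c, of n a b]
          by (simp add: mult_ac del: fps_hypergeo_nth of_nat_Suc)
        ultimately show ?case by (simp only: mult_cancel_left) simp
      qed
    qed
  next
    assume F: ?hyp
    have nth: "fps_nth F n = fps_nth F 0 * fps_nth (fps_hypergeo [a, b] [c] 1) n" for n
      by (subst F) (simp del: fps_hypergeo_nth)
    show "\<forall>n. of_nat (Suc n) * (c + of_nat n) * fps_nth F (Suc n)
                      = (a + of_nat n) * (b + of_nat n) * fps_nth F n"
    proof
      fix n
      show "of_nat (Suc n) * (c + of_nat n) * fps_nth F (Suc n)
                      = (a + of_nat n) * (b + of_nat n) * fps_nth F n"
        using arg_cong[OF fps_hypergeo2_Suc[OF c, of n a b], of "\<lambda>t. fps_nth F 0 * t"]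
        unfolding nth[of n] nth[of "Suc n"] by (simp only: mult_ac)
    qed
  qed
  finally show ?thesis .
qed

lemma hypergeo_F_has_fps_expansion:
  assumes "c \<notin> \<int>\<^sub>\<le>\<^sub>0"
  shows "hypergeo_F a b c has_fps_expansion fps_hypergeo [a, b] [c] 1"
proof -
  have "fps_conv_radius (fps_hypergeo [a, b] [c] 1) > 0"
    using fps_conv_radius_hypergeo2[OF assms, of a b]  by (rule less_le_trans[rotated]) simp
  moreover have "hypergeo_F a b c = eval_fps (fps_hypergeo [a, b] [c] 1)"
    by (rule ext) (rule hypergeo_F_eq_eval_fps)
  ultimately show ?thesis by (simp add: eval_fps_has_fps_expansion del: fps_hypergeo_nth)
qed

lemma hypergeo_F_holomorphic:
  assumes "c \<notin> \<int>\<^sub>\<le>\<^sub>0"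
  shows "hypergeo_F a b c holomorphic_on ball 0 1"
proof -
  have "hypergeo_F a b c = eval_fps (fps_hypergeo [a, b] [c] 1)"
    by (rule ext) (rule hypergeo_F_eq_eval_fps)
  moreover have "ball (0::complex) 1 \<subseteq> eball 0 (fps_conv_radius (fps_hypergeo [a, b] [c] 1))"
    using ball_eball_mono[of 1 _ "0::complex"] fps_conv_radius_hypergeo2[OF assms, of a b]
    by (simp add: one_ereal_def del: fps_hypergeo_nth)
  ultimately show ?thesis by (simp add: holomorphic_on_eval_fps del: fps_hypergeo_nth)
qed

lemma hypergeo_F_at_0: "hypergeo_F a b c 0 = 1"
  by (simp add: hypergeo_F_eq_eval_fps eval_fps_at_0 del: fps_hypergeo_nth)

section \<open>Gauss's summation theorem\<close>

text \<open>
  Quotients of rising factorials in terms of Gauss's product for \<open>1/\<Gamma>\<close>. This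
  one identity gives the growth of the coefficients (with \<open>d = 1\<close>) and the limit of
  the products in Gauss's theorem (with \<open>a + b = c + d\<close>, where the exponential
  factor disappears).
\<close>

lemma rGamma_series_quotient:
  fixes a b c d :: complex
  shows "pochhammer a (Suc n) * pochhammer b (Suc n) / (pochhammer c (Suc n) * pochhammer d (Suc n))
       = exp ((a + b - c - d) * of_real (ln (of_nat n))) *
         (rGamma_series a n * rGamma_series b n / (rGamma_series c n * rGamma_series d n))"
  by (simp add: rGamma_series_def field_simps exp_diff exp_add)

lemma hypergeo_term_bound:
  fixes a b c :: complex
  assumes c: "c \<notin> \<int>\<^sub>\<le>\<^sub>0"
  obtains K where "K > 0" 
    "\<And>n. n > 0 \<Longrightarrow> norm (fps_nth (fps_hypergeo [a, b] [c] 1) (Suc n)) \<le> K * real n powr (- 1 - Re (c - a - b))"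
proof -
  let ?Q = "\<lambda>n. rGamma_series a n * rGamma_series b n / (rGamma_series c n * rGamma_series 1 n)"
  have "?Q \<longlonglongrightarrow> rGamma a * rGamma b / (rGamma c * rGamma 1)"
    using c by (intro tendsto_intros) (auto simp: rGamma_eq_zero_iff)
  hence "Bseq ?Q" by (intro convergent_imp_Bseq convergentI)
  then obtain K where K: "K > 0" "\<And>n. norm (?Q n) \<le> K" by (elim BseqE) auto
  show ?thesis
  proof (rule that[OF K(1)])
    fix n :: nat assume n: "n > 0"
    have "fps_nth (fps_hypergeo [a, b] [c] 1) (Suc n) =
        exp ((a + b - c - 1) * of_real (ln (of_nat n))) * ?Q n"
      using rGamma_series_quotient[of a n b c 1] by (simp flip: pochhammer_fact del: fact_Suc)
    hence "norm (fps_nth (fps_hypergeo [a, b] [c] 1) (Suc n)) =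
        norm (exp ((a + b - c - 1) * of_real (ln (of_nat n)))) * norm (?Q n)"
      by (simp only: norm_mult)
    also have "norm (exp ((a + b - c - 1) * of_real (ln (of_nat n)))) = real n powr (- 1 - Re (c - a - b))"
      using n by (simp add: powr_def algebra_simps)
    also have "\<dots> * norm (?Q n) \<le> \<dots> * K" by (intro mult_left_mono K) auto
    finally show "norm (fps_nth (fps_hypergeo [a, b] [c] 1) (Suc n)) \<le> K * real n powr (- 1 - Re (c - a - b))"
      by (simp add: mult.commute)
  qed
qed

lemma summable_hypergeo_at_1:
  fixes a b c :: complex
  assumes c: "c \<notin> \<int>\<^sub>\<le>\<^sub>0" and pos: "Re (c - a - b) > 0"
  shows "summable (\<lambda>n. norm (fps_nth (fps_hypergeo [a, b] [c] 1) n))"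
proof -
  obtain K where K: "K > 0"
    "\<And>n. n > 0 \<Longrightarrow> norm (fps_nth (fps_hypergeo [a, b] [c] 1) (Suc n)) \<le> K * real n powr (- 1 - Re (c - a - b))"
    using hypergeo_term_bound[OF c] by metis
  have "summable (\<lambda>n. norm (fps_nth (fps_hypergeo [a, b] [c] 1) (Suc n)))"
  proof (rule summable_comparison_test_ev)
    show "\<forall>\<^sub>F n in sequentially. norm (norm (fps_nth (fps_hypergeo [a, b] [c] 1) (Suc n)))
        \<le> K * real n powr (- 1 - Re (c - a - b))"
      using eventually_gt_at_top[of 0] by eventually_elim (use K in \<open>auto simp del: fps_hypergeo_nth\<close>)
    show "summable (\<lambda>n. K * real n powr (- 1 - Re (c - a - b)))"
      using pos by (intro summable_mult) (subst summable_real_powr_iff, simp)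
  qed
  thus ?thesis by (subst (asm) summable_Suc_iff)
qed

lemma hypergeo_F_sums_at_1:
  fixes a b c :: complex
  assumes "c \<notin> \<int>\<^sub>\<le>\<^sub>0" "Re (c - a - b) > 0"
  shows "(\<lambda>n. fps_nth (fps_hypergeo [a, b] [c] 1) n) sums hypergeo_F a b c 1"
  using summable_sums[OF summable_norm_cancel[OF summable_hypergeo_at_1[OF assms]]]
  by (simp add: hypergeo_F_eq_eval_fps eval_fps_def del: fps_hypergeo_nth)

text \<open>
  The boundary term of the telescoping sum behind the contiguity relation vanishes in the limit.
\<close>

lemma hypergeo_term_mult_tendsto_0:
  fixes a b c :: complex
  assumes c: "c \<notin> \<int>\<^sub>\<le>\<^sub>0" and pos: "Re (c - a - b) > 0"
  shows "(\<lambda>n. of_nat n * fps_nth (fps_hypergeo [a, b] [c] 1) n) \<longlonglongrightarrow> 0"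
proof -
  define d where "d = Re (c - a - b)"
  obtain K where K: "K > 0"
    "\<And>n. n > 0 \<Longrightarrow> norm (fps_nth (fps_hypergeo [a, b] [c] 1) (Suc n)) \<le> K * real n powr (- 1 - d)"
    using hypergeo_term_bound[OF c] unfolding d_def by metis
  have lim: "(\<lambda>n. 2 * K * real n powr (- d)) \<longlonglongrightarrow> 2 * K * 0"
    using pos unfolding d_def[symmetric]
    by (intro tendsto_intros tendsto_neg_powr filterlim_real_sequentially) auto
  have "(\<lambda>n. of_nat (Suc n) * fps_nth (fps_hypergeo [a, b] [c] 1) (Suc n)) \<longlonglongrightarrow> 0"
  proof (rule Lim_null_comparison)
    show "(\<lambda>n. 2 * K * real n powr (- d)) \<longlonglongrightarrow> 0" using lim by simp
    show "\<forall>\<^sub>F n in sequentially. norm (of_nat (Suc n) * fps_nth (fps_hypergeo [a, b] [c] 1) (Suc n))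
        \<le> 2 * K * real n powr (- d)"
      using eventually_gt_at_top[of 0]
    proof eventually_elim
      case (elim n)
      have "norm (of_nat (Suc n) * fps_nth (fps_hypergeo [a, b] [c] 1) (Suc n))
          \<le> (2 * real n) * (K * real n powr (- 1 - d))"
        unfolding norm_mult norm_of_nat using elim by (intro mult_mono K) auto
      also have "\<dots> = 2 * K * (real n powr 1 * real n powr (- 1 - d))"
        using elim by simp
      also have "\<dots> = 2 * K * real n powr (- d)"
        unfolding powr_add[symmetric] by simp
      finally show ?case .
    qed
  qed
  thus ?thesis by (rule LIMSEQ_imp_Suc)
qed

text \<open>
  Termwise, the difference of the two sides is \<open>c (n t_n - (n + 1) t_{n+1})\<close> for
  the coefficients \<open>t_n\<close> of the series with parameter \<open>c\<close>, so the sum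
  telescopes to \<open>0\<close>.
\<close>

lemma hypergeo_F_contiguous_at_1:
  fixes a b c :: complex
  assumes c: "c \<notin> \<int>\<^sub>\<le>\<^sub>0" and pos: "Re (c - a - b) > 0"
  shows "c * (c - a - b) * hypergeo_F a b c 1 = (c - a) * (c - b) * hypergeo_F a b (c + 1) 1"
proof -
  let ?t = "\<lambda>n. fps_nth (fps_hypergeo [a, b] [c] 1) n"
  let ?s = "\<lambda>n. fps_nth (fps_hypergeo [a, b] [c + 1] 1) n"
  have c1: "c + 1 \<notin> \<int>\<^sub>\<le>\<^sub>0" using c plus_one_in_nonpos_Ints_imp by blast
  have nz: "c + of_nat n \<noteq> 0" for n using c by (metis plus_of_nat_eq_0_imp)
  have st: "(c + of_nat n) * ?s n = c * ?t n" for n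
  proof (cases n)
    case (Suc m)
    have "pochhammer (c + 1) n * c = pochhammer c n * (c + of_nat n)"
      by (metis pochhammer_rec pochhammer_rec' mult.commute)
    moreover have "pochhammer (c + 1) n \<noteq> 0" "pochhammer c n \<noteq> 0"
      using c c1 pochhammer_eq_0_imp_nonpos_Int by blast+
    ultimately show ?thesis by (simp add: divide_simps) algebra
  qed simp
  have tele: "c * (c - a - b) * ?t n - (c - a) * (c - b) * ?s n
        = c * (of_nat n * ?t n) - c * (of_nat (Suc n) * ?t (Suc n))" (is "?l = ?r") for n
  proof -
    have "(c + of_nat n) * ?l
        = (c + of_nat n) * (c * (c - a - b) * ?t n) - (c - a) * (c - b) * ((c + of_nat n) * ?s n)"
      by algebra
    also have "\<dots> = c * ((c + of_nat n) * of_nat n * ?t n - (a + of_nat n) * (b + of_nat n) * ?t n)"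
      unfolding st by algebra
    also have "\<dots> = (c + of_nat n) * ?r"
      unfolding fps_hypergeo2_Suc[OF c, symmetric] by algebra
    finally show ?thesis using nz[of n] by (simp only: mult_cancel_left) simp
  qed
  have "(\<lambda>n. c * (of_nat n * ?t n) - c * (of_nat (Suc n) * ?t (Suc n))) sums (c * (of_nat 0 * ?t 0) - c * 0)"
    by (intro telescope_sums' tendsto_intros hypergeo_term_mult_tendsto_0 assms)
  hence 1: "(\<lambda>n. c * (c - a - b) * ?t n - (c - a) * (c - b) * ?s n) sums 0"
    unfolding tele by simp
  have t: "?t sums hypergeo_F a b c 1"
    by (rule hypergeo_F_sums_at_1[OF c pos])
  have s: "?s sums hypergeo_F a b (c + 1) 1"
    using pos by (intro hypergeo_F_sums_at_1 c1) simp
  have "(\<lambda>n. c * (c - a - b) * ?t n - (c - a) * (c - b) * ?s n) sums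
      (c * (c - a - b) * hypergeo_F a b c 1 - (c - a) * (c - b) * hypergeo_F a b (c + 1) 1)"
    by (intro sums_diff sums_mult t s)
  from sums_unique2[OF 1 this] show ?thesis by simp
qed

lemma norm_le_norm_add_of_real:
  fixes c :: complex
  assumes "Re c \<ge> 0" "0 \<le> m"
  shows "norm c \<le> norm (c + of_real m)"
proof -
  have "(Re c)\<^sup>2 \<le> (Re c + m)\<^sup>2" using assms by (intro power_mono) auto
  thus ?thesis by (simp add: cmod_def)
qed

text \<open>
  For \<open>Re c > 0\<close>, translating \<open>c\<close> to the right does not decrease any
  factor of the rising factorial in norm; keeping the first factor exact gains the decay in
  \<open>m\<close> that forces the tail of the series to vanish.
\<close>

lemma norm_pochhammer_shift:
  fixes c :: complex
  assumes "Re c > 0" 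
  shows "norm (pochhammer c (Suc n)) * norm (c + of_nat m) \<le> norm (pochhammer (c + of_nat m) (Suc n)) * norm c"
proof -
  have "norm (pochhammer (c + 1) n) \<le> norm (pochhammer (c + of_nat m + 1) n)"
    unfolding pochhammer_prod prod_norm[symmetric]
  proof (intro prod_mono conjI norm_ge_zero)
    fix i
    show "norm (c + 1 + of_nat i) \<le> norm (c + of_nat m + 1 + of_nat i)"
      using norm_le_norm_add_of_real[of "c + 1 + of_nat i" "real m"] assms by (simp add: add_ac)
  qed
  hence "norm (pochhammer (c + 1) n) * (norm c * norm (c + of_nat m)) \<le> 
         norm (pochhammer (c + of_nat m + 1) n) * (norm c * norm (c + of_nat m))"
    by (intro mult_right_mono) auto
  thus ?thesis by (simp add: pochhammer_rec norm_mult mult_ac)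
qed

text \<open>
  Every coefficient except the constant one is bounded by \<open>norm c / norm (c + m)\<close>
  times the corresponding coefficient for \<open>m = 0\<close>, and the latter are absolutely
  summable.
\<close>

lemma hypergeo_F_at_1_large_c:
  fixes a b c :: complex
  assumes c: "Re c > 0" and pos: "Re (c - a - b) > 0"
  shows "(\<lambda>m. hypergeo_F a b (c + of_nat m) 1) \<longlonglongrightarrow> 1"
proof -
  let ?t = "\<lambda>m n. fps_nth (fps_hypergeo [a, b] [c + of_nat m] 1) n"
  have cm: "c + of_nat m \<notin> \<int>\<^sub>\<le>\<^sub>0" for m using c by (intro Re_pos_not_nonpos_Int) auto
  have sum: "summable (\<lambda>n. norm (?t m n))" for m
    using pos by (intro summable_hypergeo_at_1 cm) auto
  define S where "S = (\<Sum>n. norm (?t 0 (Suc n)))"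
  have bound: "norm (hypergeo_F a b (c + of_nat m) 1 - 1) \<le> norm c * S / norm (c + of_nat m)" for m
  proof -
    have le: "norm (?t m (Suc n)) \<le> norm c / norm (c + of_nat m) * norm (?t 0 (Suc n))" for n
    proof -
      have nz: "pochhammer (c + of_nat m) (Suc n) \<noteq> 0" "pochhammer c (Suc n) \<noteq> 0" "c + of_nat m \<noteq> 0"
        using cm[of m] cm[of 0] pochhammer_eq_0_imp_nonpos_Int by force+
      have "1 / norm (pochhammer (c + of_nat m) (Suc n))
            \<le> norm c / norm (c + of_nat m) * (1 / norm (pochhammer c (Suc n)))"
        using norm_pochhammer_shift[OF c, of n m] nz
        by (simp add: divide_simps mult_ac del: pochhammer_Suc)
      hence "norm (pochhammer a (Suc n) * pochhammer b (Suc n) / fact (Suc n)) * (1 / norm (pochhammer (c + of_nat m) (Suc n)))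
            \<le> norm (pochhammer a (Suc n) * pochhammer b (Suc n) / fact (Suc n)) * (norm c / norm (c + of_nat m) * (1 / norm (pochhammer c (Suc n))))"
        by (intro mult_left_mono) auto
      thus ?thesis by (simp add: norm_mult norm_divide mult_ac del: fact_Suc)
    qed
    have sums: "?t m sums hypergeo_F a b (c + of_nat m) 1"
      using pos by (intro hypergeo_F_sums_at_1 cm) simp
    hence "(\<lambda>n. ?t m (Suc n)) sums (hypergeo_F a b (c + of_nat m) 1 - ?t m 0)"
      by (subst sums_Suc_iff) (simp only: diff_add_cancel)
    hence "hypergeo_F a b (c + of_nat m) 1 - 1 = (\<Sum>n. ?t m (Suc n))"
      by (simp add: sums_iff del: fps_hypergeo_nth)
    also have "norm \<dots> \<le> (\<Sum>n. norm (?t m (Suc n)))"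
      using sum[of m] by (intro summable_norm) (subst summable_Suc_iff)
    also have "\<dots> \<le> (\<Sum>n. norm c / norm (c + of_nat m) * norm (?t 0 (Suc n)))"
      using sum by (intro suminf_le le summable_mult) (subst summable_Suc_iff, blast)+
    also have "\<dots> = norm c / norm (c + of_nat m) * S"
      unfolding S_def using sum[of 0] by (intro suminf_mult) (subst summable_Suc_iff)
    finally show ?thesis by simp
  qed
  have "filterlim (\<lambda>m. norm (c + of_nat m)) at_top sequentially"
  proof (rule filterlim_at_top_mono[OF filterlim_real_sequentially], rule always_eventually, rule allI)
    fix m
    show "real m \<le> norm (c + of_nat m)" using complex_Re_le_cmod[of "c + of_nat m"] c by simp
  qed
  hence "(\<lambda>m. norm c * S / norm (c + of_nat m)) \<longlonglongrightarrow> 0"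
    by (rule real_tendsto_divide_at_top[OF tendsto_const])
  hence "(\<lambda>m. hypergeo_F a b (c + of_nat m) 1 - 1) \<longlonglongrightarrow> 0"
    by (rule Lim_null_comparison[rotated]) (simp add: bound)
  thus ?thesis by (simp add: LIM_zero_iff)
qed

text \<open>
  Iterating the contiguity relation pushes \<open>c\<close> to infinity, where the series tends
  to \<open>1\<close>; the accumulated factors form a quotient of rising factorials whose limit
  is the product of Gamma values.
\<close>

theorem hypergeo_F_Gauss:
  fixes a b c :: complex
  assumes c: "Re c > 0" and pos: "Re (c - a - b) > 0"
  shows "hypergeo_F a b c 1 = Gamma c * Gamma (c - a - b) * rGamma (c - a) * rGamma (c - b)"
proof -
  let ?P = "\<lambda>m. pochhammer (c - a) m * pochhammer (c - b) m / (pochhammer c m * pochhammer (c - a - b) m)"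
  have c': "c \<notin> \<int>\<^sub>\<le>\<^sub>0" "c - a - b \<notin> \<int>\<^sub>\<le>\<^sub>0"
    by (fact Re_pos_not_nonpos_Int[OF c], fact Re_pos_not_nonpos_Int[OF pos])
  have F: "hypergeo_F a b c 1 = ?P m * hypergeo_F a b (c + of_nat m) 1" for m
  proof (induction m)
    case (Suc m)
    have nz: "pochhammer c m \<noteq> 0" "pochhammer (c - a - b) m \<noteq> 0" "c + of_nat m \<noteq> 0" "c - a - b + of_nat m \<noteq> 0"
      using c' pochhammer_eq_0_imp_nonpos_Int plus_of_nat_eq_0_imp by blast+
    have "(c + of_nat m) * (c - a - b + of_nat m) * hypergeo_F a b (c + of_nat m) 1
        = (c - a + of_nat m) * (c - b + of_nat m) * hypergeo_F a b (c + of_nat (Suc m)) 1"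
      using hypergeo_F_contiguous_at_1[of "c + of_nat m" a b] assms
      by (simp add: Re_pos_not_nonpos_Int algebra_simps)
    hence "hypergeo_F a b (c + of_nat m) 1 = (c - a + of_nat m) * (c - b + of_nat m)
           / ((c + of_nat m) * (c - a - b + of_nat m)) * hypergeo_F a b (c + of_nat (Suc m)) 1"
      using nz(3,4) by (simp add: divide_simps mult_ac)
    with Suc show ?case by (simp add: pochhammer_Suc mult_ac)
  qed simp
  have "(\<lambda>n. rGamma_series (c - a) n * rGamma_series (c - b) n
             / (rGamma_series c n * rGamma_series (c - a - b) n))
      \<longlonglongrightarrow> rGamma (c - a) * rGamma (c - b) / (rGamma c * rGamma (c - a - b))"
    using c' by (intro tendsto_intros) (auto simp: rGamma_eq_zero_iff)
  moreover have "?P (Suc n) = rGamma_series (c - a) n * rGamma_series (c - b) n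
             / (rGamma_series c n * rGamma_series (c - a - b) n)" for n
    by (subst rGamma_series_quotient) simp
  ultimately have "(\<lambda>n. ?P (Suc n)) \<longlonglongrightarrow> rGamma (c - a) * rGamma (c - b) / (rGamma c * rGamma (c - a - b))"
    by (simp only:)
  hence "(\<lambda>n. ?P (Suc n) * hypergeo_F a b (c + of_nat (Suc n)) 1) \<longlonglongrightarrow>
     rGamma (c - a) * rGamma (c - b) / (rGamma c * rGamma (c - a - b)) * 1"
    using hypergeo_F_at_1_large_c[OF assms, THEN LIMSEQ_Suc] by (rule tendsto_mult)
  moreover have "(\<lambda>n. ?P (Suc n) * hypergeo_F a b (c + of_nat (Suc n)) 1) = (\<lambda>_. hypergeo_F a b c 1)"
    using F[symmetric] by (rule ext)
  ultimately have "hypergeo_F a b c 1 = rGamma (c - a) * rGamma (c - b) / (rGamma c * rGamma (c - a - b)) * 1"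
    by (simp add: LIMSEQ_const_iff)
  thus ?thesis by (simp add: rGamma_inverse_Gamma field_simps)
qed

text \<open>
  The coefficients are absolutely summable, so the partial sums converge uniformly on the closed
  disc.
\<close>

lemma hypergeo_F_continuous_cball:
  fixes a b c :: complex
  assumes c: "c \<notin> \<int>\<^sub>\<le>\<^sub>0" and pos: "Re (c - a - b) > 0"
  shows "continuous_on (cball 0 1) (hypergeo_F a b c)"
proof (rule uniform_limit_theorem)
  let ?t = "fps_nth (fps_hypergeo [a, b] [c] 1)"
  show "\<forall>\<^sub>F n in sequentially. continuous_on (cball 0 1) (\<lambda>x. \<Sum>i<n. ?t i * x ^ i)"
    by (intro always_eventually allI continuous_intros)
  have "uniform_limit (cball 0 1) (\<lambda>n x. \<Sum>i<n. ?t i * x ^ i) (\<lambda>x. \<Sum>i. ?t i * x ^ i) sequentially"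
  proof (rule Weierstrass_m_test)
    show "norm (?t n * x ^ n) \<le> norm (?t n)" if "x \<in> cball 0 1" for n x
      using that by (simp add: norm_mult norm_power mult_left_le power_le_one del: fps_hypergeo_nth)
  qed (rule summable_hypergeo_at_1[OF assms])
  thus "uniform_limit (cball 0 1) (\<lambda>n x. \<Sum>i<n. ?t i * x ^ i) (hypergeo_F a b c) sequentially"
    by (simp add: hypergeo_F_eq_eval_fps[abs_def] eval_fps_def del: fps_hypergeo_nth)
qed auto

section \<open>The quartic transformation\<close>

definition quartic :: "complex \<Rightarrow> complex" where
  "quartic x = - x * (x + 8) ^ 3 / (64 * (1 - x) ^ 3)"

text \<open>
  The numerator is a square: both points over \<open>1\<close> are double points.
\<close>

lemma one_minus_quartic:
  assumes "x \<noteq> 1"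
  shows "1 - quartic x = (x\<^sup>2 - 20 * x - 8)\<^sup>2 / (64 * (1 - x) ^ 3)"
proof -
  have "1 - x \<noteq> 0" using assms by simp
  thus ?thesis unfolding quartic_def by (simp add: divide_simps) algebra
qed

lemma quartic_deriv:
  assumes "x \<noteq> 1"
  shows "(quartic has_field_derivative (x + 8)\<^sup>2 * (x\<^sup>2 - 20 * x - 8) / (64 * (1 - x) ^ 4)) (at x)"
proof -
  have "1 - x \<noteq> 0" using assms by simp
  thus ?thesis unfolding quartic_def
    by (auto intro!: derivative_eq_intros simp: divide_simps) algebra
qed

lemma quartic_deriv2:
  assumes "x \<noteq> 1"
  shows "((\<lambda>x. (x + 8)\<^sup>2 * (x\<^sup>2 - 20 * x - 8) / (64 * (1 - x) ^ 4)) has_field_derivative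
            - 27 * (x + 8) * (5 * x + 4) / (16 * (1 - x) ^ 5)) (at (x::complex))"
proof -
  have "1 - x \<noteq> 0" using assms by simp
  thus ?thesis
    by (auto intro!: derivative_eq_intros simp: divide_simps) algebra
qed

text \<open>
  The algebraic core of the transformation. Let \<open>y\<close>, \<open>y1\<close>,
  \<open>y2\<close> be the quartic map and its first two derivatives at \<open>x\<close>, with
  \<open>v\<close> standing for \<open>1 / (1 - x)\<close>, and let \<open>h0\<close>,
  \<open>h1\<close>, \<open>h2\<close> be the value and derivatives of a function at
  \<open>y\<close>. Then \<open>p * v * h0 + y1 * h1\<close> and the factor of \<open>x * (1 -
  x)\<close> on the left are the first two derivatives of the composition multiplied by
  \<open>(1 - x) powr (- p)\<close>, after division by that power. The hypergeometric operator
  applied to the pullback is a multiple of the operator with parameters \<open>\<alpha>\<close>,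
  \<open>\<beta>\<close> at \<open>y\<close>. Using \<open>v\<close> instead of a quotient turns
  everything into polynomial identities.
\<close>

lemma quartic_pullback_ode:
  fixes a x v h0 h1 h2 :: complex
  defines "p \<equiv> 3 * a / 2 - 1 / 4" and "b \<equiv> 2 * a - 1 / 3"
    and "\<alpha> \<equiv> a / 2 - 1 / 12" and "\<beta> \<equiv> 1 / 4 - a / 2"
    and "y \<equiv> - x * (x + 8) ^ 3 * v ^ 3 / 64"
    and "y1 \<equiv> (x + 8)\<^sup>2 * (x\<^sup>2 - 20 * x - 8) * v ^ 4 / 64"
    and "y2 \<equiv> - 27 * (x + 8) * (5 * x + 4) * v ^ 5 / 16"
  assumes v: "v * (1 - x) = 1"
  shows "x * (1 - x) * (p * (p + 1) * v\<^sup>2 * h0 + (2 * p * v * y1 + y2) * h1 + y1\<^sup>2 * h2)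
           + (2 / 3 - (a + b + 1) * x) * (p * v * h0 + y1 * h1) - a * b * h0
         = - (x + 8) * v *
           (y * (1 - y) * h2 + (2 / 3 - (\<alpha> + \<beta> + 1) * y) * h1 - \<alpha> * \<beta> * h0)"
proof -
  define w k Q where "w = 1 - x" and "k = x + 8" and "Q = x\<^sup>2 - 20 * x - 8"
  have vw: "v * w = 1" using v by (simp add: w_def)
  \<comment> \<open>Here and below, powers of \<open>v * w = 1\<close> are inserted so that a power of \<open>v\<close> can be factored out.\<close>
  have "1 - y = (v * w) ^ 3 - y" by (simp add: vw)
  also have "\<dots> = (64 * w ^ 3 + x * k ^ 3) * v ^ 3 / 64"
    by (simp add: y_def k_def field_simps)
  also have "64 * w ^ 3 + x * k ^ 3 = Q\<^sup>2"
    unfolding w_def k_def Q_def by algebra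
  finally have y': "1 - y = Q\<^sup>2 * v ^ 3 / 64" .
  have "x * w * y1\<^sup>2 = v * w * (x * k ^ 4 * Q\<^sup>2 * v ^ 7 / 4096)"
    unfolding y1_def k_def[symmetric] Q_def[symmetric]
    by (simp add: field_simps eval_nat_numeral)
  also have "\<dots> = - k * v * (y * (1 - y))"
    unfolding vw y' unfolding y_def k_def[symmetric]
    by (simp add: field_simps eval_nat_numeral)
  finally have h2: "x * w * y1\<^sup>2 = - k * v * (y * (1 - y))" .
  have "x * w * (2 * p * v * y1 + y2) + (2 / 3 - (a + b + 1) * x) * y1
          = k * v ^ 4 * (x * (v * w) * (2 * p * k * Q / 64 - 27 * (5 * x + 4) / 16)
              + (2 / 3 - (a + b + 1) * x) * k * Q / 64)"
    unfolding y1_def y2_def k_def[symmetric] Q_def[symmetric]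
    by (simp add: field_simps eval_nat_numeral)
  also have "\<dots> = - k * v ^ 4 * (2 / 3 * w ^ 3 + (\<alpha> + \<beta> + 1) * x * k ^ 3 / 64)"
    unfolding vw unfolding k_def Q_def w_def p_def b_def \<alpha>_def \<beta>_def
    by (simp add: field_simps eval_nat_numeral)
  also have "\<dots> = - k * v * (2 / 3 * (v * w) ^ 3 - (\<alpha> + \<beta> + 1) * y)"
    unfolding y_def k_def[symmetric]
    by (simp add: field_simps eval_nat_numeral)
  also have "\<dots> = - k * v * (2 / 3 - (\<alpha> + \<beta> + 1) * y)"
    by (simp add: vw)
  finally have h1: "x * w * (2 * p * v * y1 + y2) + (2 / 3 - (a + b + 1) * x) * y1
          = - k * v * (2 / 3 - (\<alpha> + \<beta> + 1) * y)" .
  have "x * w * (p * (p + 1) * v\<^sup>2) + (2 / 3 - (a + b + 1) * x) * (p * v) - a * b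
        = (v * w) * (x * p * (p + 1) * v) + (2 / 3 - (a + b + 1) * x) * (p * v) - a * b * (v * w)"
    by (simp add: vw) (simp add: vw field_simps eval_nat_numeral)
  also have "\<dots> = v * (x * p * (p + 1) + (2 / 3 - (a + b + 1) * x) * p - a * b * w)"
    by (subst (1) vw) algebra
  also have "\<dots> = - k * v * (- \<alpha> * \<beta>)"
    unfolding k_def w_def p_def b_def \<alpha>_def \<beta>_def
    by (simp add: field_simps eval_nat_numeral)
  finally have h0: "x * w * (p * (p + 1) * v\<^sup>2) + (2 / 3 - (a + b + 1) * x) * (p * v) - a * b
        = - k * v * (- \<alpha> * \<beta>)" .
  have "x * w * (p * (p + 1) * v\<^sup>2 * h0 + (2 * p * v * y1 + y2) * h1 + y1\<^sup>2 * h2)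
           + (2 / 3 - (a + b + 1) * x) * (p * v * h0 + y1 * h1) - a * b * h0
     = (x * w * y1\<^sup>2) * h2
      + (x * w * (2 * p * v * y1 + y2) + (2 / 3 - (a + b + 1) * x) * y1) * h1
      + (x * w * (p * (p + 1) * v\<^sup>2) + (2 / 3 - (a + b + 1) * x) * (p * v) - a * b) * h0"
    by algebra
  also have "\<dots> = - k * v * (y * (1 - y) * h2 + (2 / 3 - (\<alpha> + \<beta> + 1) * y) * h1 - \<alpha> * \<beta> * h0)"
    unfolding h0 h1 h2 by algebra
  finally show ?thesis unfolding w_def k_def .
qed

lemma quartic_holomorphic [holomorphic_intros]: "quartic holomorphic_on ball 0 1"
  unfolding quartic_def by (intro holomorphic_intros) auto

text \<open>
  The part of the unit disc on which composing a power series of radius \<open>1\<close> with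
  the quartic map makes sense.
\<close>

definition quartic_dom :: "complex set" where
  "quartic_dom = ball 0 1 \<inter> quartic -` ball 0 1"

lemma open_quartic_dom: "open quartic_dom"
  unfolding quartic_dom_def
  by (intro continuous_open_preimage holomorphic_on_imp_continuous_on quartic_holomorphic) auto

lemma zero_in_quartic_dom: "0 \<in> quartic_dom"
  by (simp add: quartic_dom_def quartic_def)

definition pullback :: "complex \<Rightarrow> complex \<Rightarrow> complex" where
  "pullback a x = (1 - x) powr (1 / 4 - 3 * a / 2) *
     hypergeo_F (a / 2 - 1 / 12) (1 / 4 - a / 2) (2 / 3) (quartic x)"

lemma pullback_holomorphic: "pullback a holomorphic_on quartic_dom"
proof -
  have "hypergeo_F (a / 2 - 1 / 12) (1 / 4 - a / 2) (2 / 3) \<circ> quartic holomorphic_on quartic_dom"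
    by (rule holomorphic_on_compose_gen[where t = "ball 0 1"])
       (auto simp: quartic_dom_def Re_pos_not_nonpos_Int
             intro!: hypergeo_F_holomorphic holomorphic_on_subset[OF quartic_holomorphic])
  moreover have "1 - x \<notin> \<real>\<^sub>\<le>\<^sub>0" if "x \<in> quartic_dom" for x
    using that complex_Re_le_cmod[of x] by (auto simp: quartic_dom_def complex_nonpos_Reals_iff)
  ultimately show ?thesis unfolding pullback_def o_def
    by (intro holomorphic_intros) auto
qed

text \<open>
  The equation of the function that is pulled back is assumed only at the one point
  \<open>quartic x\<close>; it will be available for \<open>x\<close> close to \<open>0\<close>,
  which suffices for comparing power series.
\<close>

lemma pullback_ode:
  assumes x: "x \<in> quartic_dom"
    and ode: "let y = quartic x; h = hypergeo_F (a / 2 - 1 / 12) (1 / 4 - a / 2) (2 / 3) in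
        y * (1 - y) * deriv (deriv h) y
          + (2 / 3 - (a / 2 - 1 / 12 + (1 / 4 - a / 2) + 1) * y) * deriv h y
          - (a / 2 - 1 / 12) * (1 / 4 - a / 2) * h y = 0"
  shows "x * (1 - x) * deriv (deriv (pullback a)) x
           + (2 / 3 - (a + (2 * a - 1 / 3) + 1) * x) * deriv (pullback a) x
           - a * (2 * a - 1 / 3) * pullback a x = 0"
proof -
  define h where "h = hypergeo_F (a / 2 - 1 / 12) (1 / 4 - a / 2) (2 / 3)"
  define p where "p = 3 * a / 2 - 1 / 4"
  define P where "P = (\<lambda>x::complex. (1 - x) powr (- p))"
  define y1 where "y1 = (\<lambda>x::complex. (x + 8)\<^sup>2 * (x\<^sup>2 - 20 * x - 8) / (64 * (1 - x) ^ 4))"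
  define y2 where "y2 = (\<lambda>x::complex. - 27 * (x + 8) * (5 * x + 4) / (16 * (1 - x) ^ 5))"
  have g: "pullback a = (\<lambda>x. P x * h (quartic x))"
    by (auto simp: pullback_def P_def p_def h_def)
  have hol: "h holomorphic_on ball 0 1" "deriv h holomorphic_on ball 0 1"
    unfolding h_def by (intro holomorphic_deriv hypergeo_F_holomorphic; simp add: Re_pos_not_nonpos_Int)+
  have h: "(h has_field_derivative deriv h y) (at y)"
     and h': "(deriv h has_field_derivative deriv (deriv h) y) (at y)" if "y \<in> ball 0 1" for y
    using that hol by (auto intro!: holomorphic_derivI[where S = "ball 0 1"])
  have dom: "x \<noteq> 1" "1 - x \<noteq> 0" "1 - x \<notin> \<real>\<^sub>\<le>\<^sub>0" "quartic x \<in> ball 0 1" if "x \<in> quartic_dom" for x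
    using that complex_Re_le_cmod[of x] by (auto simp: quartic_dom_def complex_nonpos_Reals_iff)
  have P: "(P has_field_derivative p / (1 - x) * P x) (at x)" if "x \<in> quartic_dom" for x
    unfolding P_def using dom[OF that]
    by (auto intro!: derivative_eq_intros simp: powr_diff divide_simps)
  have q: "(quartic has_field_derivative y1 x) (at x)"
          "(y1 has_field_derivative y2 x) (at x)" if "x \<in> quartic_dom" for x
    using quartic_deriv quartic_deriv2 dom[OF that] unfolding y1_def y2_def by auto
  have hq: "((\<lambda>x. h (quartic x)) has_field_derivative deriv h (quartic x) * y1 x) (at x)"
           "((\<lambda>x. deriv h (quartic x)) has_field_derivative deriv (deriv h) (quartic x) * y1 x) (at x)"
    if "x \<in> quartic_dom" for x
    using DERIV_chain2[OF h q(1)] DERIV_chain2[OF h' q(1)] dom that by auto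
  define g1 where "g1 = (\<lambda>x. P x * (p / (1 - x) * h (quartic x) + y1 x * deriv h (quartic x)))"
  define g2 where "g2 = (\<lambda>x. P x * (p * (p + 1) / (1 - x)\<^sup>2 * h (quartic x)
      + (2 * p / (1 - x) * y1 x + y2 x) * deriv h (quartic x) + (y1 x)\<^sup>2 * deriv (deriv h) (quartic x)))"
  have g1: "(pullback a has_field_derivative g1 x) (at x)" if "x \<in> quartic_dom" for x
    unfolding g g1_def using dom[OF that]
    by (auto intro!: derivative_eq_intros P hq that simp: algebra_simps)
  define r where "r = (\<lambda>x::complex. p / (1 - x))"
  have r: "(r has_field_derivative p / (1 - x)\<^sup>2) (at x)" if "x \<in> quartic_dom" for x
    unfolding r_def using dom[OF that]
    by (auto intro!: derivative_eq_intros simp: power2_eq_square)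
  have Pr: "(P has_field_derivative r x * P x) (at x)" if "x \<in> quartic_dom" for x
    using P[OF that] by (simp add: r_def)
  have g1_r: "g1 = (\<lambda>x. P x * (r x * h (quartic x) + y1 x * deriv h (quartic x)))"
    unfolding g1_def r_def ..
  have g2_r: "g2 x = P x * (((r x)\<^sup>2 + p / (1 - x)\<^sup>2) * h (quartic x)
      + (2 * r x * y1 x + y2 x) * deriv h (quartic x) + (y1 x)\<^sup>2 * deriv (deriv h) (quartic x))" for x
    unfolding g2_def r_def by (simp add: power_divide power2_eq_square algebra_simps add_divide_distrib)
  have g2: "(g1 has_field_derivative g2 x) (at x)" if "x \<in> quartic_dom" for x
    unfolding g1_r g2_r
    by (auto intro!: derivative_eq_intros Pr r hq q that simp: algebra_simps power2_eq_square)
  have d1: "deriv (pullback a) x = g1 x" if "x \<in> quartic_dom" for x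
    using g1[OF that] by (rule DERIV_imp_deriv)
  have "(deriv (pullback a) has_field_derivative g2 x) (at x)"
    by (rule has_field_derivative_transform_within_open[OF g2[OF x] open_quartic_dom x])
       (simp add: d1)
  hence d2: "deriv (deriv (pullback a)) x = g2 x" by (rule DERIV_imp_deriv)
  define v where "v = 1 / (1 - x)"
  have v: "v * (1 - x) = 1" using dom[OF x] by (simp add: v_def)
  have pw: "u / (k * (1 - x) ^ n) = u * v ^ n / k" "u / (1 - x) = u * v" for u k n
    by (simp_all add: v_def power_divide)
  have y: "quartic x = - x * (x + 8) ^ 3 * v ^ 3 / 64"
    "y1 x = (x + 8)\<^sup>2 * (x\<^sup>2 - 20 * x - 8) * v ^ 4 / 64"
    "y2 x = - 27 * (x + 8) * (5 * x + 4) * v ^ 5 / 16"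
    unfolding quartic_def y1_def y2_def pw by simp_all
  have ode': "quartic x * (1 - quartic x) * deriv (deriv h) (quartic x)
          + (2 / 3 - (a / 2 - 1 / 12 + (1 / 4 - a / 2) + 1) * quartic x) * deriv h (quartic x)
          - (a / 2 - 1 / 12) * (1 / 4 - a / 2) * h (quartic x) = 0"
    using ode unfolding Let_def h_def .
  have "x * (1 - x) * g2 x + (2 / 3 - (a + (2 * a - 1 / 3) + 1) * x) * g1 x
           - a * (2 * a - 1 / 3) * pullback a x
     = P x * (x * (1 - x) * (p * (p + 1) * v\<^sup>2 * h (quartic x)
            + (2 * p * v * y1 x + y2 x) * deriv h (quartic x) + (y1 x)\<^sup>2 * deriv (deriv h) (quartic x))
           + (2 / 3 - (a + (2 * a - 1 / 3) + 1) * x) * (p * v * h (quartic x) + y1 x * deriv h (quartic x))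
           - a * (2 * a - 1 / 3) * h (quartic x))"
    unfolding g g1_def g2_def v_def by (simp add: algebra_simps power_divide)
  also have "\<dots> = P x * (- (x + 8) * v * 0)"
    unfolding y p_def quartic_pullback_ode[OF v] unfolding y(1)[symmetric] ode' ..
  finally show ?thesis using d1[OF x] d2 by simp
qed

lemma hypergeo_F_eq_pullback_near_0:
  "\<forall>\<^sub>F x in nhds 0. hypergeo_F a (2 * a - 1 / 3) (2 / 3) x = pullback a x"
proof -
  let ?h = "hypergeo_F (a / 2 - 1 / 12) (1 / 4 - a / 2) (2 / 3)"
  have c: "(2 / 3 :: complex) \<notin> \<int>\<^sub>\<le>\<^sub>0" by (rule Re_pos_not_nonpos_Int) simp
  have "\<forall>\<^sub>F y in nhds 0. y * (1 - y) * deriv (deriv ?h) y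
          + (2 / 3 - (a / 2 - 1 / 12 + (1 / 4 - a / 2) + 1) * y) * deriv ?h y
          - (a / 2 - 1 / 12) * (1 / 4 - a / 2) * ?h y = 0"
    by (subst hypergeo_ode_iff[OF hypergeo_F_has_fps_expansion[OF c] c])
       (simp only: fps_hypergeo_0 fps_const_1_eq_1 mult_1)
  moreover have "filterlim quartic (nhds 0) (nhds 0)"
  proof -
    have "isCont quartic 0" using quartic_deriv[of 0] DERIV_isCont by force
    moreover have "quartic 0 = 0" by (simp add: quartic_def)
    ultimately show ?thesis using isCont_def tendsto_at_iff_tendsto_nhds by metis
  qed
  ultimately have "\<forall>\<^sub>F x in nhds 0. let y = quartic x in y * (1 - y) * deriv (deriv ?h) y
          + (2 / 3 - (a / 2 - 1 / 12 + (1 / 4 - a / 2) + 1) * y) * deriv ?h y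
          - (a / 2 - 1 / 12) * (1 / 4 - a / 2) * ?h y = 0"
    unfolding Let_def by (rule eventually_compose_filterlim)
  moreover have "\<forall>\<^sub>F x in nhds 0. x \<in> quartic_dom"
    using open_quartic_dom zero_in_quartic_dom by (rule eventually_nhds_in_open)
  ultimately have ode: "\<forall>\<^sub>F x in nhds 0. x * (1 - x) * deriv (deriv (pullback a)) x
           + (2 / 3 - (a + (2 * a - 1 / 3) + 1) * x) * deriv (pullback a) x
           - a * (2 * a - 1 / 3) * pullback a x = 0"
    by eventually_elim (rule pullback_ode, auto simp: Let_def)
  define G where "G = fps_expansion (pullback a) 0"
  have G: "pullback a has_fps_expansion G"
    unfolding G_def
    by (rule has_fps_expansion_fps_expansion[OF open_quartic_dom zero_in_quartic_dom pullback_holomorphic])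
  have "fps_nth G 0 = 1"
    using has_fps_expansion_imp_0_eq_fps_nth_0[OF G]
    by (simp add: pullback_def quartic_def hypergeo_F_at_0)
  with ode have "G = fps_hypergeo [a, 2 * a - 1 / 3] [2 / 3] 1"
    unfolding hypergeo_ode_iff[OF G c] by (simp only: fps_const_1_eq_1 mult_1)
  with G have "pullback a has_fps_expansion fps_hypergeo [a, 2 * a - 1 / 3] [2 / 3] 1" by simp
  hence "\<forall>\<^sub>F x in nhds 0. eval_fps (fps_hypergeo [a, 2 * a - 1 / 3] [2 / 3] 1) x = pullback a x"
    unfolding has_fps_expansion_def by blast
  thus ?thesis by (simp only: hypergeo_F_eq_eval_fps)
qed

text \<open>
  Analytic continuation from \<open>0\<close> reaches the component of \<open>0\<close> in the
  domain; the set \<open>S\<close> witnesses that \<open>x\<close> lies in it.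
\<close>

lemma hypergeo_F_eq_pullback:
  assumes S: "S \<subseteq> quartic_dom" "connected S" "0 \<in> S" "x \<in> S"
  shows "hypergeo_F a (2 * a - 1 / 3) (2 / 3) x = pullback a x"
proof -
  define C where "C = connected_component_set quartic_dom 0"
  have C: "open C" "connected C" "S \<subseteq> C" "C \<subseteq> quartic_dom"
    unfolding C_def using S connected_component_maximal[of 0 S quartic_dom]
    by (auto intro: open_connected_component open_quartic_dom
          connected_component_subset[THEN subsetD])
  obtain T where T: "open T" "0 \<in> T"
    "\<And>x. x \<in> T \<Longrightarrow> hypergeo_F a (2 * a - 1 / 3) (2 / 3) x = pullback a x"
    using hypergeo_F_eq_pullback_near_0[of a] unfolding eventually_nhds by blast
  show ?thesis
  proof (rule analytic_continuation_open[where s = "T \<inter> C" and s' = C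
        and f = "hypergeo_F a (2 * a - 1 / 3) (2 / 3)" and g = "pullback a"])
    show "hypergeo_F a (2 * a - 1 / 3) (2 / 3) holomorphic_on C"
      using C(4) by (intro holomorphic_on_subset[OF hypergeo_F_holomorphic])
        (auto simp: quartic_dom_def Re_pos_not_nonpos_Int)
    show "pullback a holomorphic_on C"
      using C(4) pullback_holomorphic by (rule holomorphic_on_subset[rotated])
  qed (use T C S in auto)
qed

section \<open>Evaluation at the critical point\<close>

lemma quartic_of_real:
  "quartic (of_real t) = of_real (- t * (t + 8) ^ 3 / (64 * (1 - t) ^ 3))"
  by (simp add: quartic_def)

lemma sqrt_3_bounds: "17 / 10 < sqrt 3" "sqrt 3 < 9 / 5"
  by (rule real_less_rsqrt, simp add: power2_eq_square)
     (rule real_less_lsqrt; simp add: power2_eq_square)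

text \<open>
  For non-positive \<open>t\<close> the quartic map is non-negative, and \<open>1\<close> minus
  it is a square divided by a positive number; the square vanishes only at the points \<open>10
  \<plusminus> 6 \<surd>3\<close>.
\<close>

lemma quartic_segment:
  fixes t :: real
  assumes "10 - 6 * sqrt 3 < t" "t \<le> 0"
  shows "of_real t \<in> quartic_dom" 
proof -
  note s = sqrt_3_bounds
  have t: "- 1 < t" using assms s by simp
  let ?q = "- t * (t + 8) ^ 3 / (64 * (1 - t) ^ 3)"
  have "0 \<le> ?q" using assms t by (intro divide_nonneg_pos mult_nonneg_nonneg) auto
  moreover have "1 - ?q = (t\<^sup>2 - 20 * t - 8)\<^sup>2 / (64 * (1 - t) ^ 3)"
  proof -
    have "complex_of_real (1 - ?q) = of_real ((t\<^sup>2 - 20 * t - 8)\<^sup>2 / (64 * (1 - t) ^ 3))"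
      using one_minus_quartic[of "of_real t"] assms unfolding quartic_of_real by simp
    thus ?thesis by (simp only: of_real_eq_iff)
  qed
  moreover have "t\<^sup>2 - 20 * t - 8 < 0"
  proof -
    have "(10 - t)\<^sup>2 < (6 * sqrt 3)\<^sup>2" using assms s by (intro power_strict_mono) auto
    also have "\<dots> = 108" by (simp add: power_mult_distrib)
    finally show ?thesis by (simp add: power2_eq_square algebra_simps)
  qed
  hence "(t\<^sup>2 - 20 * t - 8)\<^sup>2 / (64 * (1 - t) ^ 3) > 0"
    using assms by (intro divide_pos_pos) auto
  ultimately have "\<bar>?q\<bar> < 1" by simp
  hence "norm (quartic (of_real t)) < 1" unfolding quartic_of_real norm_of_real .
  moreover have "norm (complex_of_real t) < 1" using t assms by simp
  ultimately show ?thesis by (simp add: quartic_dom_def)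
qed

lemma quartic_eq_1: "quartic (of_real (10 - 6 * sqrt 3)) = 1"
proof -
  define t where "t = 10 - 6 * sqrt 3"
  have "t\<^sup>2 - 20 * t - 8 = 0" by (simp add: t_def power2_eq_square algebra_simps)
  hence "complex_of_real (t\<^sup>2 - 20 * t - 8) = 0" by (simp only: of_real_0)
  hence "(complex_of_real t)\<^sup>2 - 20 * of_real t - 8 = 0" by simp
  moreover have "complex_of_real t \<noteq> 1"
    using sqrt_3_bounds unfolding of_real_eq_1_iff t_def by simp
  ultimately show ?thesis using one_minus_quartic[of "of_real t"] unfolding t_def by simp
qed

text \<open>
  At the endpoint the quartic map reaches the unit circle, so the identity is obtained there as
  a limit along the segment.
\<close>

lemma hypergeo_F_eq_pullback_at_endpoint:
  "hypergeo_F a (2 * a - 1 / 3) (2 / 3) (of_real (10 - 6 * sqrt 3)) = pullback a (of_real (10 - 6 * sqrt 3))"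
proof -
  define x0 where "x0 = 10 - 6 * sqrt 3"
  note s = sqrt_3_bounds
  have x0: "-1 < x0" "x0 < 0" using s by (simp_all add: x0_def)
  have cl: "closure {x0<..0} = {x0..0}" using x0 by (simp add: closure_greaterThanAtMost)
  define D where "D = (\<lambda>t. hypergeo_F a (2 * a - 1 / 3) (2 / 3) (of_real t) - pullback a (of_real t))"
  \<comment> \<open>The left endpoint is excluded: there the quartic map leaves the open disc.\<close>
  have D0: "D t = 0" if "t \<in> {x0<..0}" for t
  proof -
    have "hypergeo_F a (2 * a - 1 / 3) (2 / 3) (of_real t) = pullback a (of_real t)"
    proof (rule hypergeo_F_eq_pullback)
      show "connected (of_real ` {x0<..0} :: complex set)"
        by (intro connected_continuous_image continuous_intros) auto
      show "of_real ` {x0<..0} \<subseteq> quartic_dom" using quartic_segment by (auto simp: x0_def)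
      show "0 \<in> (of_real ` {x0<..0} :: complex set)" using x0 by (auto intro!: image_eqI[of _ _ 0])
    qed (use that in auto)
    thus ?thesis by (simp add: D_def)
  qed
  have seg: "quartic (of_real t) \<in> cball 0 1" if "t \<in> {x0..0}" for t
    using quartic_segment[of t] quartic_eq_1 that
    by (cases "t = x0") (auto simp: x0_def quartic_dom_def)
  have qcont: "continuous_on {x0..0} (\<lambda>t. quartic (of_real t))"
    unfolding quartic_def using x0 by (intro continuous_intros) auto
  have hcont: "continuous_on {x0..0}
      (\<lambda>t. hypergeo_F (a / 2 - 1 / 12) (1 / 4 - a / 2) (2 / 3) (quartic (of_real t)))"
    by (rule continuous_on_compose2[OF hypergeo_F_continuous_cball qcont])
       (use seg in \<open>auto simp: Re_pos_not_nonpos_Int\<close>)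
  have "continuous_on {x0..0} (\<lambda>t. pullback a (of_real t))"
    unfolding pullback_def
    by (intro continuous_intros hcont) (use x0 in \<open>auto simp: complex_nonpos_Reals_iff\<close>)
  moreover have "continuous_on {x0..0} (\<lambda>t. hypergeo_F a (2 * a - 1 / 3) (2 / 3) (of_real t))"
    by (rule continuous_on_compose2[OF holomorphic_on_imp_continuous_on[OF hypergeo_F_holomorphic]])
       (use x0 in \<open>auto simp: Re_pos_not_nonpos_Int intro!: continuous_intros\<close>)
  ultimately have "continuous_on (closure {x0<..0}) D"
    unfolding D_def cl by (intro continuous_intros)
  from continuous_constant_on_closure[OF this D0] have "D x0 = 0"
    using x0 by (simp add: cl)
  thus ?thesis by (simp add: D_def x0_def)
qed

theorem mainTheorem17:
  fixes a :: complex
  shows "hypergeo_F a (2 * a - 1/3) (2/3) (of_real (10 - 6 * sqrt 3)) =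
     3 powr (3/8 - 9 * a / 4) * of_real (sqrt 3 - 1) powr (1/2 - 3 * a)
       * of_real (sqrt pi) * Gamma (2/3)
       * rGamma (3/4 - a / 2) * rGamma (a / 2 + 5/12)
       / 2 powr (1/4 - 3 * a / 2)"
proof -
  let ?w = "1 - (10 - 6 * sqrt 3)" and ?s = "1 / 4 - 3 * a / 2"
  note s = sqrt_3_bounds
  have gauss: "hypergeo_F (a / 2 - 1 / 12) (1 / 4 - a / 2) (2 / 3) 1
      = Gamma (2 / 3) * of_real (sqrt pi) * rGamma (3 / 4 - a / 2) * rGamma (a / 2 + 5 / 12)"
  proof -
    have e: "2 / 3 - (a / 2 - 1 / 12) - (1 / 4 - a / 2) = 1 / 2" "2 / 3 - (a / 2 - 1 / 12) = 3 / 4 - a / 2"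
      "2 / 3 - (1 / 4 - a / 2) = a / 2 + 5 / 12" by (simp_all add: field_simps)
    have "hypergeo_F (a / 2 - 1 / 12) (1 / 4 - a / 2) (2 / 3) 1
      = Gamma (2 / 3) * Gamma (1 / 2) * rGamma (3 / 4 - a / 2) * rGamma (a / 2 + 5 / 12)"
      using hypergeo_F_Gauss[of "2 / 3" "a / 2 - 1 / 12" "1 / 4 - a / 2"] unfolding e by simp
    thus ?thesis by (simp only: Gamma_one_half_complex)
  qed
  \<comment> \<open>Raising this factorisation to the power \<open>?s\<close> yields the powers of \<open>3\<close>, \<open>sqrt 3 - 1\<close> and \<open>2\<close> in the result.\<close>
  have w: "?w = 3 * sqrt 3 * (sqrt 3 - 1)\<^sup>2 / 2"
    by (simp add: power2_eq_square algebra_simps)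
  have ln_w: "ln ?w = 3 / 2 * ln 3 + 2 * ln (sqrt 3 - 1) - ln 2"
    unfolding w using s by (simp add: ln_mult ln_div ln_sqrt ln_realpow)
  have powr: "of_real x powr z = exp (z * of_real (ln x))" if "x > 0" for x :: real and z :: complex
    using that by (simp add: powr_def Ln_of_real)
  have "(1 - of_real (10 - 6 * sqrt 3)) powr ?s = of_real ?w powr ?s"
    by (simp only: of_real_diff of_real_1)
  also have "\<dots> = exp (?s * of_real (ln ?w))"
    using s by (intro powr) simp
  also have "?s * of_real (ln ?w) = (3 / 8 - 9 * a / 4) * of_real (ln 3)
      + (1 / 2 - 3 * a) * of_real (ln (sqrt 3 - 1)) - ?s * of_real (ln 2)"
    unfolding ln_w by (simp add: field_simps)
  also have "exp \<dots> = 3 powr (3 / 8 - 9 * a / 4) * of_real (sqrt 3 - 1) powr (1 / 2 - 3 * a) / 2 powr ?s"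
    using s powr[of 3 "3 / 8 - 9 * a / 4"] powr[of "sqrt 3 - 1" "1 / 2 - 3 * a"] powr[of 2 ?s]
    by (simp add: exp_add exp_diff)
  finally have pw: "(1 - of_real (10 - 6 * sqrt 3)) powr ?s
     = 3 powr (3 / 8 - 9 * a / 4) * of_real (sqrt 3 - 1) powr (1 / 2 - 3 * a) / 2 powr ?s" .
  show ?thesis
    unfolding hypergeo_F_eq_pullback_at_endpoint pullback_def quartic_eq_1 gauss pw
    by (simp add: field_simps)
qed

end
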